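(* For each selling candidate $\mathcal{I}\subseteq 2^{[n]}$ for $n$ items there is at most one price schedule $\{p_I\}_{I\subseteq[n]}$ that is critical with respect to $\mathcal{I}$ and submodular. Moreover, it satisfies $p_I=p_J$ whenever $\#I=\#J$ and $I,J\in\mathcal{I}$.
   Context: Let $[n]=\{1,\dots,n\}$. A price schedule is a family of real numbers $\{p_I\}_{I\subseteq[n]}$ with $p_\emptyset=0$. Its regions are, for $I\subseteq[n]$, $$D_I=\Bigl\{x\in[0,1]^n\ \Big|\ \sum_{i\in I}x_i-p_I\ge\sum_{j\in J}x_j-p_J\text{ for all }J\subseteq[n]\Bigr\}.$$ Throughout, price schedules are assumed to be normalized, i.e., $p_I=\min\{p_J\mid J\supsetneq I\}$ whenever $\mathrm{vol}_n D_I=0$. Let $\pi_I$ be the projection onto the coordinates in $I$. Put $\bar D_I=\pi_I(D_I)$ and, for $i\in I$, $\bar D_I^i=\pi_{I\setminus\{i\}}(\pi_I(D_I))$. Define $$\delta_n(I)=\mathrm{vol}_{\#I}\,\bar D_I-\frac1{n+1}\sum_{i\in I}\mathrm{vol}_{\#I-1}\,\bar D_I^i,$$ where $\mathrm{vol}_k$ denotes $k$-dimensional volume ($\mathrm{vol}_0$ of a point is $1$). A price schedule is submodular if $p_{I\cup J}+p_{I\cap J}\le p_I+p_J$ for all $I,J\subseteq[n]$. A selling candidate for $n$ items is a set $\mathcal{I}\subseteq2^{[n]}$ such that $[n]\in\mathcal{I}$, $\mathcal{I}$ contains all singletons, and for all $I\in\mathcal{I}\setminus\{[n]\}$ and $J\subseteq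 I$ we have $J\in\mathcal{I}$. A price schedule admits $\mathcal{I}$ if and only if $\mathrm{vol}_nD_I>0$ for all $I\in\mathcal{I}$. It is critical with respect to $\mathcal{I}$ if it admits $\mathcal{I}$ and additionally $\delta_n(I)=0$ for all $I\in\mathcal{I}\setminus\{\emptyset\}$.
   Formalization: "Admits 𝓘" is taken to mean vol D_I > 0 exactly for the I in 𝓘, not merely for all I in 𝓘; otherwise uniqueness fails, e.g. for n=3 and 𝓘 consisting of ∅, the singletons and [3], where the prices of the pairs can be varied. *)

theory Defs
  imports "HOL-Analysis.Analysis"
begin

(* Points of R^I, for a finite set of items I, are extensional functions on I (the carrier of
   the product measure below), so that the various projections of a region live in honest
   spaces of different dimensions; R^{} is the one-point space. *)

definition vol :: "nat set \<Rightarrow> (nat \<Rightarrow> real) set \<Rightarrow> real" where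
  "vol I A = measure (Pi\<^sub>M I (\<lambda>_. lborel)) A"

definition proj :: "nat set \<Rightarrow> (nat \<Rightarrow> real) set \<Rightarrow> (nat \<Rightarrow> real) set" where
  "proj I A = (\<lambda>x. restrict x I) ` A"

(* A family of prices indexed by the subsets of {1..n} is a function on all sets of naturals;
   only its values on subsets of {1..n} are ever used. *)

definition region :: "nat \<Rightarrow> (nat set \<Rightarrow> real) \<Rightarrow> nat set \<Rightarrow> (nat \<Rightarrow> real) set" where
  "region n p I =
     {x \<in> {1..n} \<rightarrow>\<^sub>E {0..1}. \<forall>J \<subseteq> {1..n}. (\<Sum>i\<in>I. x i) - p I \<ge> (\<Sum>j\<in>J. x j) - p J}"

(* The full set {1..n} has no proper superset, so the normalization condition is imposed on
   proper subsets only and Min is never applied to the empty set. *)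

definition normalized :: "nat \<Rightarrow> (nat set \<Rightarrow> real) \<Rightarrow> bool" where
  "normalized n p \<longleftrightarrow>
     (\<forall>I. I \<subset> {1..n} \<and> vol {1..n} (region n p I) = 0
        \<longrightarrow> p I = Min {p J |J. I \<subset> J \<and> J \<subseteq> {1..n}})"

definition price_schedule :: "nat \<Rightarrow> (nat set \<Rightarrow> real) \<Rightarrow> bool" where
  "price_schedule n p \<longleftrightarrow> p {} = 0 \<and> normalized n p"

definition submodular :: "nat \<Rightarrow> (nat set \<Rightarrow> real) \<Rightarrow> bool" where
  "submodular n p \<longleftrightarrow>
     (\<forall>I J. I \<subseteq> {1..n} \<and> J \<subseteq> {1..n} \<longrightarrow> p (I \<union> J) + p (I \<inter> J) \<le> p I + p J)"

definition bar_region :: "nat \<Rightarrow> (nat set \<Rightarrow> real) \<Rightarrow> nat set \<Rightarrow> (nat \<Rightarrow> real) set" where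
  "bar_region n p I = proj I (region n p I)"

definition bar_region_facet :: "nat \<Rightarrow> (nat set \<Rightarrow> real) \<Rightarrow> nat set \<Rightarrow> nat \<Rightarrow> (nat \<Rightarrow> real) set" where
  "bar_region_facet n p I i = proj (I - {i}) (proj I (region n p I))"

definition delta :: "nat \<Rightarrow> (nat set \<Rightarrow> real) \<Rightarrow> nat set \<Rightarrow> real" where
  "delta n p I =
     vol I (bar_region n p I)
       - 1 / (real n + 1) * (\<Sum>i\<in>I. vol (I - {i}) (bar_region_facet n p I i))"

definition selling_candidate :: "nat \<Rightarrow> nat set set \<Rightarrow> bool" where
  "selling_candidate n \<I> \<longleftrightarrow>
     \<I> \<subseteq> Pow {1..n} \<and> {1..n} \<in> \<I> \<and> (\<forall>i\<in>{1..n}. {i} \<in> \<I>) \<and>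
     (\<forall>I \<in> \<I> - {{1..n}}. \<forall>J \<subseteq> I. J \<in> \<I>)"

(* The candidate is exactly the collection of bundles that are sold with positive probability:
   regions outside it have volume zero.  If positive volume were only required on the candidate, the prices
   of bundles outside the candidate would not be determined by the criticality equations, and
   critical submodular price schedules would not be unique (already for n = 3 and the candidate
   without the three pairs). *)

definition admits :: "nat \<Rightarrow> (nat set \<Rightarrow> real) \<Rightarrow> nat set set \<Rightarrow> bool" where
  "admits n p \<I> \<longleftrightarrow> (\<forall>I \<subseteq> {1..n}. I \<in> \<I> \<longleftrightarrow> vol {1..n} (region n p I) > 0)"

definition critical :: "nat \<Rightarrow> (nat set \<Rightarrow> real) \<Rightarrow> nat set set \<Rightarrow> bool" where
  "critical n p \<I> \<longleftrightarrow> admits n p \<I> \<and> (\<forall>I \<in> \<I> - {{}}. delta n p I = 0)"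

end

theory Submission
  imports Defs
begin

text \<open>
  The deficiency of a bundle \<open>I\<close> depends only on the prices of subsets of \<open>I\<close>. Hence it suffices to
  show that, once the prices of the proper subsets of \<open>I\<close> are known, at most one price of \<open>I\<close> itself makes the
  deficiency vanish. Both assertions then follow by induction on the size of \<open>I\<close>: two
  critical schedules are compared on the same bundle, or one critical schedule is compared on two bundles of
  equal size by relabelling items.

  The heart of the matter is that the deficiency of \<open>I\<close> strictly decreases when the price of \<open>I\<close> rises,
  provided that the sold proper subsets of \<open>I\<close> have deficiency zero and the raised prices are submodular.
  Let this price rise from \<open>t\<close> to \<open>q I\<close>. The region of \<open>I\<close> loses the valuations
  whose owner now prefers some \<open>A \<subset> I\<close>. For submodular prices, optimality of
  \<open>A\<close> splits into a condition on the items in \<open>A\<close>, namely that all of \<open>A\<close> is worth buying, and a condition on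
  the items outside \<open>A\<close>, namely that no further items are worth adding (\<open>piece_optimal\<close>).
  So the lost part is, up to null sets, a disjoint union of products of the projected region of \<open>A\<close> with a
  set \<open>slab A\<close> that carries the dependence on the rise (\<open>piecewise_decomposition\<close>). The faces
  decompose in the same way: since every single item costs less than \<open>1\<close>, the product belonging to \<open>A\<close> touches the face \<open>x\<^sub>i = 1\<close> only for
  \<open>i \<in> A\<close> (\<open>top_face_piece\<close>). Therefore the loss in deficiency is
  \<open>\<Sum>A. vol (slab A) * deficiency A\<close> (\<open>deficiency_diff\<close>). By criticality
  every nonempty \<open>A\<close> contributes zero, and the empty bundle, whose deficiency is \<open>1\<close>, contributes
  \<open>vol (slab {})\<close>. This volume is positive because submodular functions have a nonempty base polytope
  (\<open>slab_empty_pos\<close>).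

  Bundles outside the candidate need a separate remark: normalization forces them to cost as much as the full
  bundle (\<open>price_unsold\<close>), so they impose no condition on the region of the full bundle and never occur
  as the bundle that is bought instead.
\<close>

section \<open>Volumes of sets of valuations\<close>

abbreviation leb :: "nat set \<Rightarrow> (nat \<Rightarrow> real) measure" where
  "leb I \<equiv> Pi\<^sub>M I (\<lambda>_. lborel)"

abbreviation cube :: "nat set \<Rightarrow> (nat \<Rightarrow> real) set" where
  "cube I \<equiv> I \<rightarrow>\<^sub>E {0..1}"

interpretation lborels: product_sigma_finite "\<lambda>_::nat. lborel :: real measure"
  by standard

lemma space_leb: "space (leb I) = extensional I"
  by (auto simp: space_PiM PiE_def)

lemma sum_measurable_leb:
  assumes "A \<subseteq> I"
  shows "(\<lambda>x. sum x A) \<in> borel_measurable (leb I)"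
proof (rule borel_measurable_sum)
  fix i assume "i \<in> A"
  then have "i \<in> I" using assms by auto
  then have "(\<lambda>x. x i) \<in> measurable (leb I) lborel"
    by (rule measurable_component_singleton)
  then show "(\<lambda>x. x i) \<in> borel_measurable (leb I)" by simp
qed

lemma cube_sets: "finite I \<Longrightarrow> cube I \<in> sets (leb I)"
  by (rule sets_PiM_I_finite) auto

lemma cube_emeasure: "finite I \<Longrightarrow> emeasure (leb I) (cube I) = 1"
  by (subst lborels.emeasure_PiM) auto

lemma fmeasurable_subset_cube:
  assumes "finite I" "S \<in> sets (leb I)" "S \<subseteq> cube I"
  shows "S \<in> fmeasurable (leb I)"
proof -
  have "emeasure (leb I) S \<le> 1"
    using emeasure_mono[OF assms(3) cube_sets[OF assms(1)]] cube_emeasure[OF assms(1)] by simp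
  then show ?thesis using assms(2)
    by (auto intro!: fmeasurableI simp: less_top[symmetric] top_unique)
qed

lemma vol_box:
  assumes "finite I" "\<And>i. i \<in> I \<Longrightarrow> a i \<le> b i"
  shows "vol I (Pi\<^sub>E I (\<lambda>i. {a i..b i})) = (\<Prod>i\<in>I. b i - a i)"
proof -
  have "emeasure (leb I) (Pi\<^sub>E I (\<lambda>i. {a i..b i})) = (\<Prod>i\<in>I. ennreal (b i - a i))"
    using assms by (subst lborels.emeasure_PiM) (auto intro!: prod.cong)
  also have "\<dots> = ennreal (\<Prod>i\<in>I. b i - a i)"
    using assms by (subst prod_ennreal) auto
  finally show ?thesis
    using assms by (simp add: vol_def measure_def prod_nonneg)
qed

text \<open>Ties between two bundles take place on such hyperplanes. This is what makes regions
  that only meet along ties additive in volume.\<close>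

lemma hyperplane_null:
  assumes "finite I" "A \<subseteq> I" "C \<subseteq> I" "A \<noteq> C"
  shows "{x \<in> extensional I. sum x A - sum x C = c} \<in> null_sets (leb I)"
proof -
  obtain j where j: "j \<in> I" "(j \<in> A) \<noteq> (j \<in> C)" using assms by blast
  define K where "K = I - {j}"
  have I: "I = insert j K" "j \<notin> K" "finite K" using j assms by (auto simp: K_def)
  let ?H = "{x \<in> extensional I. sum x A - sum x C = c}"
  have "{x \<in> space (leb I). sum x A - sum x C = c} \<in> sets (leb I)"
    using sum_measurable_leb[OF assms(2)] sum_measurable_leb[OF assms(3)] by measurable
  then have sets: "?H \<in> sets (leb I)" by (simp only: space_leb)
  have fin: "finite A" "finite C" using assms finite_subset by auto
  \<comment> \<open>On a line in a direction \<open>j\<close> in which \<open>A\<close> and \<open>C\<close> differ, the equation has a single solution;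
    the second candidate point covers the case that \<open>j\<close> is in \<open>C\<close> instead of \<open>A\<close>.\<close>
  have line: "(\<integral>\<^sup>+y. indicator ?H (x(j := y)) \<partial>lborel) = (0::ennreal)" for x
  proof -
    define s where "s = sum x (A - {j}) - sum x (C - {j})"
    have u: "sum (x(j := y)) A - sum (x(j := y)) C = s + (if j \<in> A then y else 0) - (if j \<in> C then y else 0)" for y
    proof -
      have "sum (x(j := y)) B = sum x (B - {j}) + (if j \<in> B then y else 0)" if "finite B" for B
      proof -
        have "sum (x(j := y)) (B - {j}) = sum x (B - {j})" by (rule sum.cong) auto
        then show ?thesis using sum.remove[OF that, of j "x(j := y)"] by (cases "j \<in> B") auto
      qed
      then show ?thesis using fin by (simp add: s_def)
    qed
    have "{y. x(j := y) \<in> ?H} \<subseteq> {c - s, s - c}"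
    proof
      fix y assume "y \<in> {y. x(j := y) \<in> ?H}"
      then have "sum (x(j := y)) A - sum (x(j := y)) C = c" by blast
      then have "s + (if j \<in> A then y else 0) - (if j \<in> C then y else 0) = c" by (simp only: u)
      then show "y \<in> {c - s, s - c}" using j(2) by (auto split: if_splits)
    qed
    then have "countable {y. x(j := y) \<in> ?H}" by (rule countable_subset) auto
    then have "{y. x(j := y) \<in> ?H} \<in> null_sets lborel" by (rule countable_imp_null_set_lborel)
    moreover have "(\<lambda>y. indicator ?H (x(j := y)) :: ennreal) = indicator {y. x(j := y) \<in> ?H}"
      by (auto simp: indicator_def fun_eq_iff)
    ultimately show ?thesis by (simp add: null_sets_def)
  qed
  have "emeasure (leb I) ?H = (\<integral>\<^sup>+x. indicator ?H x \<partial>leb I)" using sets by simp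
  also have "\<dots> = (\<integral>\<^sup>+x. (\<integral>\<^sup>+y. indicator ?H (x(j := y)) \<partial>lborel) \<partial>leb K)"
    using lborels.product_nn_integral_insert[OF I(3,2), of "indicator ?H"] sets I(1) by simp
  also have "\<dots> = 0" by (simp only: line) simp
  finally show ?thesis using sets by (simp add: null_sets_def)
qed

lemma vol_UNION_disjoint_AE:
  assumes "finite I" "finite F" "\<And>A. A \<in> F \<Longrightarrow> S A \<in> sets (leb I)" "\<And>A. A \<in> F \<Longrightarrow> S A \<subseteq> cube I"
    "\<And>A C. A \<in> F \<Longrightarrow> C \<in> F \<Longrightarrow> A \<noteq> C \<Longrightarrow> \<exists>N \<in> null_sets (leb I). S A \<inter> S C \<subseteq> N"
  shows "vol I (\<Union>A\<in>F. S A) = (\<Sum>A\<in>F. vol I (S A))"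
  unfolding vol_def
proof (rule measure_UNION_AE)
  show "pairwise (\<lambda>m n. AE x in leb I. x \<notin> S m \<or> x \<notin> S n) F"
  proof (rule pairwiseI)
    fix A C assume "A \<in> F" "C \<in> F" "A \<noteq> C"
    from assms(5)[OF this] obtain N where "N \<in> null_sets (leb I)" "S A \<inter> S C \<subseteq> N" by auto
    then show "AE x in leb I. x \<notin> S A \<or> x \<notin> S C"
      by (intro AE_I'[of N]) auto
  qed
qed (use assms(1-4) in \<open>blast intro: fmeasurable_subset_cube\<close>)+

text \<open>The product \<open>S \<times> T\<close>, written inside the functions on \<open>A \<union> B\<close> instead of as a set of
  pairs.\<close>

definition glue_region :: "nat set \<Rightarrow> (nat \<Rightarrow> real) set \<Rightarrow> nat set \<Rightarrow> (nat \<Rightarrow> real) set \<Rightarrow> (nat \<Rightarrow> real) set" where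
  "glue_region A S B T = {x \<in> extensional (A \<union> B). restrict x A \<in> S \<and> restrict x B \<in> T}"

lemma glue_region_sets:
  assumes "S \<in> sets (leb A)" "T \<in> sets (leb B)"
  shows "glue_region A S B T \<in> sets (leb (A \<union> B))"
proof -
  have [measurable]: "(\<lambda>x. restrict x A) \<in> measurable (leb (A \<union> B)) (leb A)"
    "(\<lambda>x. restrict x B) \<in> measurable (leb (A \<union> B)) (leb B)"
    by (rule measurable_restrict_subset; simp)+
  note [measurable] = assms
  have "{x \<in> space (leb (A \<union> B)). restrict x A \<in> S \<and> restrict x B \<in> T} \<in> sets (leb (A \<union> B))"
    by measurable
  then show ?thesis by (simp add: glue_region_def space_leb)
qed

lemma vol_glue_region:
  assumes fin: "finite A" "finite B" and disj: "A \<inter> B = {}"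
    and S: "S \<in> sets (leb A)" and T: "T \<in> sets (leb B)"
  shows "vol (A \<union> B) (glue_region A S B T) = vol A S * vol B T"
proof -
  interpret B: sigma_finite_measure "leb B" by (rule lborels.sigma_finite) fact
  have sub: "S \<subseteq> extensional A" "T \<subseteq> extensional B"
    using S T sets.sets_into_space space_leb by blast+
  have m: "merge A B \<in> measurable (leb A \<Otimes>\<^sub>M leb B) (leb (A \<union> B))" by (rule measurable_merge)
  have pre: "merge A B -` glue_region A S B T \<inter> space (leb A \<Otimes>\<^sub>M leb B) = S \<times> T"
  proof -
    have "merge A B (x, y) \<in> glue_region A S B T \<longleftrightarrow> x \<in> S \<and> y \<in> T"
      if "x \<in> extensional A" "y \<in> extensional B" for x y
      using that disj by (simp add: glue_region_def extensional_restrict)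
    then show ?thesis using sub by (auto simp: space_pair_measure space_leb subset_iff)
  qed
  have "emeasure (leb (A \<union> B)) (glue_region A S B T) = emeasure (leb A \<Otimes>\<^sub>M leb B) (S \<times> T)"
    by (subst lborels.distr_merge[OF disj fin, symmetric])
       (subst emeasure_distr[OF m glue_region_sets[OF S T]], simp add: pre)
  also have "\<dots> = emeasure (leb A) S * emeasure (leb B) T"
    using S T by (rule B.emeasure_pair_measure_Times)
  finally show ?thesis by (simp add: vol_def measure_def enn2real_mult)
qed

text \<open>Relabelling items preserves volume. It lets bundles with equally many items be compared as
  one bundle under two price systems.\<close>

lemma vol_reindex:
  assumes "finite I" "bij_betw f I J" "S \<in> sets (leb I)"
  shows "vol I S = vol J {x \<in> extensional J. (\<lambda>i\<in>I. x (f i)) \<in> S}"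
proof -
  have fJ: "f i \<in> J" if "i \<in> I" for i using assms(2) that by (auto simp: bij_betw_def)
  have finJ: "finite J" using assms bij_betw_finite by blast
  let ?T = "\<lambda>x. \<lambda>i\<in>I. x (f i)"
  have T: "?T \<in> measurable (leb J) (leb I)"
    by (intro measurable_restrict measurable_component_singleton fJ)
  have "distr (leb J) (leb I) ?T = leb I"
  proof (rule lborels.PiM_eqI)
    fix A assume A: "\<And>i. i \<in> I \<Longrightarrow> A i \<in> sets (lborel :: real measure)"
    let ?B = "\<lambda>j. A (inv_into I f j)"
    have inv: "inv_into I f j \<in> I" "f (inv_into I f j) = j" if "j \<in> J" for j
      using assms(2) that by (auto simp: bij_betw_def f_inv_into_f inv_into_into)
    have inv': "inv_into I f (f i) = i" if "i \<in> I" for i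
      using assms(2) that by (auto simp: bij_betw_def)
    have pre: "?T -` Pi\<^sub>E I A \<inter> space (leb J) = Pi\<^sub>E J ?B"
    proof (intro equalityI subsetI)
      fix x assume x: "x \<in> ?T -` Pi\<^sub>E I A \<inter> space (leb J)"
      show "x \<in> Pi\<^sub>E J ?B"
      proof (rule PiE_I)
        fix j assume "j \<in> J"
        have "?T x (inv_into I f j) \<in> ?B j" using x inv[OF \<open>j \<in> J\<close>] by (auto simp: PiE_iff)
        then show "x j \<in> ?B j" using inv[OF \<open>j \<in> J\<close>] by simp
      qed (use x in \<open>auto simp: space_leb extensional_def\<close>)
    next
      fix x assume x: "x \<in> Pi\<^sub>E J ?B"
      have "x (f i) \<in> A i" if "i \<in> I" for i
        using PiE_mem[OF x fJ[OF that]] inv'[OF that] by simp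
      then show "x \<in> ?T -` Pi\<^sub>E I A \<inter> space (leb J)" using x
        by (auto simp: space_leb PiE_def)
    qed
    have "emeasure (distr (leb J) (leb I) ?T) (Pi\<^sub>E I A) = emeasure (leb J) (Pi\<^sub>E J ?B)"
      using A assms(1) by (subst emeasure_distr[OF T]) (auto simp: pre intro!: sets_PiM_I_finite)
    also have "\<dots> = (\<Prod>j\<in>J. emeasure lborel (?B j))"
      using A inv finJ by (subst lborels.emeasure_PiM) auto
    also have "\<dots> = (\<Prod>i\<in>I. emeasure lborel (A i))"
      by (subst prod.reindex_bij_betw[OF assms(2), symmetric]) (auto intro!: prod.cong simp: inv')
    finally show "emeasure (distr (leb J) (leb I) ?T) (Pi\<^sub>E I A) = (\<Prod>i\<in>I. emeasure lborel (A i))" .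
  qed (use assms in auto)
  then have "emeasure (leb I) S = emeasure (distr (leb J) (leb I) ?T) S" by simp
  also have "\<dots> = emeasure (leb J) (?T -` S \<inter> space (leb J))"
    by (rule emeasure_distr[OF T assms(3)])
  also have "?T -` S \<inter> space (leb J) = {x \<in> extensional J. ?T x \<in> S}" by (auto simp: space_leb)
  finally show ?thesis by (simp add: vol_def measure_def)
qed

section \<open>Regions of full bundles\<close>

text \<open>The projection of the region of \<open>I\<close> to the coordinates in \<open>I\<close>, described by prices of
  subsets of \<open>I\<close> alone: buying all of \<open>I\<close> is optimal in the market with item set \<open>I\<close>. Writing
  the utility comparison with \<open>A\<close> as a lower bound on \<open>x(I - A)\<close> shows that the set is
  closed upwards in the cube.\<close>

definition full_region :: "nat set \<Rightarrow> (nat set \<Rightarrow> real) \<Rightarrow> (nat \<Rightarrow> real) set" where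
  "full_region I p = {x \<in> cube I. \<forall>A\<subseteq>I. p I - p A \<le> sum x (I - A)}"

text \<open>For an upward closed subset \<open>X\<close> of the cube, projecting along the coordinate \<open>i\<close> amounts to
  taking the slice at \<open>x\<^sub>i = 1\<close>. Slices, unlike projections, commute with set
  differences and unions, which the volume computation exploits.\<close>

definition top_face :: "nat set \<Rightarrow> nat \<Rightarrow> (nat \<Rightarrow> real) set \<Rightarrow> (nat \<Rightarrow> real) set" where
  "top_face I i X = {z \<in> extensional (I - {i}). z(i := 1) \<in> X}"

definition deficiency :: "nat \<Rightarrow> nat set \<Rightarrow> (nat set \<Rightarrow> real) \<Rightarrow> real" where
  "deficiency n I p = vol I (full_region I p)
     - 1 / (real n + 1) * (\<Sum>i\<in>I. vol (I - {i}) (top_face I i (full_region I p)))"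

lemma sum_restrict_subset: "B \<subseteq> A \<Longrightarrow> sum (restrict x A) B = sum x B"
  by (rule sum.cong) auto

lemma full_region_cong:
  assumes "\<And>A. A \<subseteq> I \<Longrightarrow> p A = q A"
  shows "full_region I p = full_region I q"
  using assms by (auto simp: full_region_def)

lemma deficiency_cong:
  assumes "\<And>A. A \<subseteq> I \<Longrightarrow> p A = q A"
  shows "deficiency n I p = deficiency n I q"
  using full_region_cong[of I p q] assms by (simp add: deficiency_def)

lemma full_region_sets:
  assumes "finite I"
  shows "full_region I p \<in> sets (leb I)"
proof -
  have "{x \<in> space (leb I). \<forall>A\<in>Pow I. p I - p A \<le> sum x (I - A)} \<in> sets (leb I)"
  proof (rule sets.sets_Collect_finite_All)
    fix A
    have [measurable]: "(\<lambda>x. sum x (I - A)) \<in> borel_measurable (leb I)"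
      by (rule sum_measurable_leb) auto
    show "{x \<in> space (leb I). p I - p A \<le> sum x (I - A)} \<in> sets (leb I)" by measurable
  qed (use assms in auto)
  then have "cube I \<inter> {x \<in> space (leb I). \<forall>A\<in>Pow I. p I - p A \<le> sum x (I - A)} \<in> sets (leb I)"
    using cube_sets[OF assms] by blast
  moreover have "cube I \<inter> {x \<in> space (leb I). \<forall>A\<in>Pow I. p I - p A \<le> sum x (I - A)} = full_region I p"
    by (auto simp: full_region_def space_leb PiE_def)
  ultimately show ?thesis by simp
qed

lemma top_face_sets:
  assumes "i \<in> I" "X \<in> sets (leb I)"
  shows "top_face I i X \<in> sets (leb (I - {i}))"
proof -
  have [measurable]: "(\<lambda>z. z(i := 1)) \<in> measurable (leb (I - {i})) (leb I)"
    by (rule measurable_fun_upd[where J = "I - {i}"]) (use assms in auto)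
  note assms(2)[measurable]
  have "{z \<in> space (leb (I - {i})). z(i := 1) \<in> X} \<in> sets (leb (I - {i}))" by measurable
  then show ?thesis by (simp add: top_face_def space_leb)
qed

lemma top_face_subset_cube:
  assumes "X \<subseteq> cube I" "i \<in> I"
  shows "top_face I i X \<subseteq> cube (I - {i})"
proof
  fix z assume z: "z \<in> top_face I i X"
  then have "z(i := 1) \<in> cube I" using assms by (auto simp: top_face_def)
  then have "z j \<in> {0..1}" if "j \<in> I - {i}" for j
    using PiE_mem[of "z(i := 1)" I "\<lambda>_. {0..1}" j] that by auto
  then show "z \<in> cube (I - {i})" using z by (auto simp: top_face_def PiE_def)
qed

section \<open>Raising the price of the full bundle\<close>

text \<open>A fixed market with item set \<open>I\<close> in which the price of the full bundle rises from \<open>t\<close> to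
  \<open>q I\<close>. The prices of the bundles in \<open>F\<close> stay the same. All other bundles cost as much as the full
  bundle, before and after the rise, so they never impose a condition on its region; this models the bundles
  that are not sold.\<close>

locale raised_price =
  fixes I :: "nat set" and q :: "nat set \<Rightarrow> real" and t :: real and F :: "nat set set"
  assumes finite: "finite I" and nonempty: "I \<noteq> {}"
    and F: "F \<subseteq> Pow I - {I}" "{} \<in> F"
    and off_F: "\<And>A. A \<subseteq> I \<Longrightarrow> A \<notin> F \<Longrightarrow> q A = q I"
    and mono: "\<And>A B. A \<subseteq> B \<Longrightarrow> B \<subseteq> I \<Longrightarrow> q A \<le> q B"
    and submod: "\<And>A B. A \<subseteq> I \<Longrightarrow> B \<subseteq> I \<Longrightarrow> q (A \<union> B) + q (A \<inter> B) \<le> q A + q B"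
    and q_empty: "q {} = 0"
    and single: "\<And>i. i \<in> I \<Longrightarrow> 0 < q {i} \<and> q {i} < 1"
    and less: "t < q I"
begin

definition low :: "nat set \<Rightarrow> real" where
  "low A = (if A \<in> F then q A else t)"

text \<open>Given that \<open>A\<close> is bought from the items in \<open>A\<close>, these are the valuations of the remaining
  items for which no enlargement of \<open>A\<close> beats \<open>A\<close> at the high price, and the full bundle is at least as good
  as \<open>A\<close> at the low price but worse at the high one.\<close>

definition slab :: "nat set \<Rightarrow> (nat \<Rightarrow> real) set" where
  "slab A = {y \<in> cube (I - A). (\<forall>C\<subseteq>I - A. sum y C \<le> q (A \<union> C) - q A) \<and>
     t - q A \<le> sum y (I - A) \<and> sum y (I - A) < q I - q A}"

definition piece :: "nat set \<Rightarrow> (nat \<Rightarrow> real) set" where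
  "piece A = glue_region A (full_region A q) (I - A) (slab A)"

lemma F_D: "A \<in> F \<Longrightarrow> A \<subseteq> I" "A \<in> F \<Longrightarrow> finite A" "A \<in> F \<Longrightarrow> A \<union> (I - A) = I"
  using F finite finite_subset by auto

lemma finite_F: "finite F"
  using F finite by (meson Diff_subset finite_Pow_iff finite_subset order_trans)

lemma low_simps: "A \<in> F \<Longrightarrow> low A = q A" "A \<notin> F \<Longrightarrow> low A = t" "low I = t"
  using F by (auto simp: low_def)

lemma slab_sets: "slab A \<in> sets (leb (I - A))"
proof -
  have [measurable]: "(\<lambda>x. sum x C) \<in> borel_measurable (leb (I - A))" if "C \<subseteq> I - A" for C
    by (rule sum_measurable_leb) (use that in auto)
  have "{y \<in> space (leb (I - A)). \<forall>C\<in>Pow (I - A). sum y C \<le> q (A \<union> C) - q A} \<in> sets (leb (I - A))"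
    by (rule sets.sets_Collect_finite_All) (use finite in auto)
  moreover have "{y \<in> space (leb (I - A)). t - q A \<le> sum y (I - A) \<and> sum y (I - A) < q I - q A}
     \<in> sets (leb (I - A))" by measurable
  moreover have "slab A = cube (I - A) \<inter>
       {y \<in> space (leb (I - A)). \<forall>C\<in>Pow (I - A). sum y C \<le> q (A \<union> C) - q A} \<inter>
       {y \<in> space (leb (I - A)). t - q A \<le> sum y (I - A) \<and> sum y (I - A) < q I - q A}"
    by (auto simp: slab_def space_leb PiE_def)
  moreover have "cube (I - A) \<in> sets (leb (I - A))" using finite by (intro cube_sets) auto
  ultimately show ?thesis by (metis (no_types, lifting) sets.Int)
qed

lemma piece_sets: "A \<in> F \<Longrightarrow> piece A \<in> sets (leb I)"
  using glue_region_sets[OF full_region_sets slab_sets, of A q A] F_D by (simp add: piece_def)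

lemma pieceD:
  assumes A: "A \<in> F" and x: "x \<in> piece A"
  shows "x \<in> cube I"
    and "B \<subseteq> A \<Longrightarrow> q A - q B \<le> sum x (A - B)"
    and "C \<subseteq> I - A \<Longrightarrow> sum x C \<le> q (A \<union> C) - q A"
    and "t - q A \<le> sum x (I - A)" and "sum x (I - A) < q I - q A"
proof -
  have ra: "restrict x A \<in> full_region A q" and rb: "restrict x (I - A) \<in> slab A" and
    e: "x \<in> extensional I"
    using x A F_D(3) by (auto simp: piece_def glue_region_def)
  have "x i \<in> {0..1}" if "i \<in> I" for i
  proof (cases "i \<in> A")
    case True
    then show ?thesis using ra PiE_mem[of "restrict x A" A "\<lambda>_. {0..1}" i]
      by (simp add: full_region_def)
  next
    case False
    then show ?thesis using rb that PiE_mem[of "restrict x (I - A)" "I - A" "\<lambda>_. {0..1}" i]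
      by (simp add: slab_def)
  qed
  then show "x \<in> cube I" using e by (auto simp: PiE_def)
  show "q A - q B \<le> sum x (A - B)" if "B \<subseteq> A"
  proof -
    have "q A - q B \<le> sum (restrict x A) (A - B)" using ra that unfolding full_region_def by blast
    then show ?thesis by (simp only: sum_restrict_subset Diff_subset)
  qed
  show "sum x C \<le> q (A \<union> C) - q A" if "C \<subseteq> I - A"
  proof -
    have "sum (restrict x (I - A)) C \<le> q (A \<union> C) - q A" using rb that unfolding slab_def by blast
    then show ?thesis using that by (simp only: sum_restrict_subset)
  qed
  have "t - q A \<le> sum (restrict x (I - A)) (I - A)" "sum (restrict x (I - A)) (I - A) < q I - q A"
    using rb unfolding slab_def by blast+
  then show "t - q A \<le> sum x (I - A)" and "sum x (I - A) < q I - q A"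
    by (simp_all only: sum_restrict_subset order_refl)
qed

lemma sum_split: "B \<subseteq> C \<Longrightarrow> C \<subseteq> I \<Longrightarrow> sum x C = sum x B + sum x (C - B)" for x :: "nat \<Rightarrow> real"
  using sum.subset_diff[of B C x] finite_subset[OF _ finite, of C] by (simp add: add.commute)

text \<open>This is the step where submodularity matters. The definition of a piece compares \<open>A\<close> only
  with bundles \<open>C\<close> below it and above it. For arbitrary \<open>C\<close>, dropping \<open>A - C\<close> from \<open>A\<close> and adding
  \<open>C - A\<close> to \<open>A\<close> are both no improvement, and by submodularity the price changes of these two moves
  add up to at most the price change of moving from \<open>A\<close> to \<open>C\<close>.\<close>

lemma piece_optimal:
  assumes A: "A \<in> F" and x: "x \<in> piece A" and C: "C \<subseteq> I"
  shows "sum x C - q C \<le> sum x A - q A"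
proof -
  note D = pieceD[OF A x]
  have "q A - q (A \<inter> C) \<le> sum x (A - A \<inter> C)" by (rule D(2)) auto
  moreover have "sum x (C - A) \<le> q (A \<union> (C - A)) - q A" by (rule D(3)) (use C in auto)
  moreover have "q (A \<union> C) + q (A \<inter> C) \<le> q A + q C" by (rule submod) (use F_D A C in auto)
  moreover have "sum x A = sum x (A \<inter> C) + sum x (A - A \<inter> C)"
    by (rule sum_split) (use F_D A in auto)
  moreover have "sum x C = sum x (A \<inter> C) + sum x (C - A \<inter> C)"
    by (rule sum_split) (use C in auto)
  moreover have "C - A \<inter> C = C - A" "A \<union> (C - A) = A \<union> C" by auto
  ultimately show ?thesis by simp
qed

text \<open>The valuations that are lost when the price of the full bundle rises, sorted by the bundle
  that is bought instead. Only bundles in \<open>F\<close> occur, since any other bundle costs the same as the full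
  bundle and offers no more.\<close>

lemma piecewise_decomposition: "full_region I low - full_region I q = (\<Union>A\<in>F. piece A)"
proof (intro equalityI subsetI)
  fix x assume x: "x \<in> full_region I low - full_region I q"
  then have cube: "x \<in> cube I" and lowx: "\<And>A. A \<subseteq> I \<Longrightarrow> t - low A \<le> sum x (I - A)"
    by (auto simp: full_region_def low_simps)
  from x obtain B where B: "B \<subseteq> I" "sum x (I - B) < q I - q B"
    by (auto simp: full_region_def not_le)
  have "\<exists>A\<in>Pow I. \<forall>C\<in>Pow I. sum x C - q C \<le> sum x A - q A"
  proof -
    let ?f = "\<lambda>C. sum x C - q C"
    have fin: "finite (?f ` Pow I)" "?f ` Pow I \<noteq> {}" using finite by auto
    then have "Max (?f ` Pow I) \<in> ?f ` Pow I" by (rule Max_in)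
    then obtain A where "A \<in> Pow I" "Max (?f ` Pow I) = ?f A" by auto
    moreover have "?f C \<le> Max (?f ` Pow I)" if "C \<in> Pow I" for C
      using fin(1) that by (intro Max_ge imageI)
    ultimately show ?thesis by auto
  qed
  then obtain A where A: "A \<subseteq> I" and opt: "\<And>C. C \<subseteq> I \<Longrightarrow> sum x C - q C \<le> sum x A - q A"
    by auto
  have tot: "sum x I = sum x C + sum x (I - C)" if "C \<subseteq> I" for C
    by (rule sum_split) (use that in auto)
  have loss: "sum x (I - A) < q I - q A"
    using opt[OF B(1)] B tot[OF A] tot[OF B(1)] by simp
  have "0 \<le> sum x (I - A)"
    using cube by (intro sum_nonneg) (auto simp: PiE_iff)
  then have AF: "A \<in> F" using off_F[OF A] loss by force
  have "restrict x A \<in> full_region A q"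
    unfolding full_region_def
  proof (intro CollectI conjI allI impI)
    show "restrict x A \<in> cube A" using cube A by (auto simp: PiE_iff)
    fix C assume C: "C \<subseteq> A"
    have "sum x A = sum x C + sum x (A - C)" by (rule sum_split) (use A C in auto)
    then show "q A - q C \<le> sum (restrict x A) (A - C)"
      using opt[OF order_trans[OF C A]] by (simp add: sum_restrict_subset)
  qed
  moreover have "restrict x (I - A) \<in> slab A"
    unfolding slab_def
  proof (intro CollectI conjI allI impI)
    show "restrict x (I - A) \<in> cube (I - A)" using cube by (auto simp: PiE_iff)
    fix C assume C: "C \<subseteq> I - A"
    have AC: "A \<union> C \<subseteq> I" using A C by auto
    have "sum x (A \<union> C) = sum x A + sum x ((A \<union> C) - A)" by (rule sum_split) (use A C in auto)
    moreover have "(A \<union> C) - A = C" using C by auto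
    ultimately show "sum (restrict x (I - A)) C \<le> q (A \<union> C) - q A"
      using opt[OF AC] by (simp only: sum_restrict_subset[OF C])
  qed (use loss lowx[OF A] low_simps AF in auto)
  ultimately have "x \<in> piece A"
    using cube F_D(3)[OF AF] by (auto simp: piece_def glue_region_def PiE_def)
  then show "x \<in> (\<Union>A\<in>F. piece A)" using AF by blast
next
  fix x assume "x \<in> (\<Union>A\<in>F. piece A)"
  then obtain A where A: "A \<in> F" and x: "x \<in> piece A" by auto
  note D = pieceD[OF A x]
  have tot: "sum x I = sum x C + sum x (I - C)" if "C \<subseteq> I" for C
    by (rule sum_split) (use that in auto)
  have "low I - low C \<le> sum x (I - C)" if C: "C \<subseteq> I" for C
  proof (cases "C \<in> F")
    case True
    then show ?thesis
      using piece_optimal[OF A x C] D(4) tot[OF C] tot[of A] F_D A by (simp add: low_simps)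
  next
    case False
    then show ?thesis using D(1) by (auto simp: low_simps PiE_iff intro!: sum_nonneg)
  qed
  then show "x \<in> full_region I low - full_region I q"
    using D(1,5) F_D(1)[OF A] by (auto simp: full_region_def not_le)
qed

lemma full_region_subset: "full_region I q \<subseteq> full_region I low"
proof
  fix x assume x: "x \<in> full_region I q"
  have "low I - low C \<le> sum x (I - C)" if C: "C \<subseteq> I" for C
  proof (cases "C \<in> F")
    case True
    have "q I - q C \<le> sum x (I - C)" using x C by (auto simp: full_region_def)
    then show ?thesis using less True by (simp add: low_simps)
  next
    case False
    then show ?thesis using x by (auto simp: full_region_def low_simps PiE_iff intro!: sum_nonneg)
  qed
  then show "x \<in> full_region I low" using x by (auto simp: full_region_def)
qed

lemma vol_split:
  assumes "finite K" "X \<in> sets (leb K)" "Y \<in> sets (leb K)" "X \<subseteq> Y" "Y \<subseteq> cube K"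
  shows "vol K Y - vol K X = vol K (Y - X)"
  unfolding vol_def
  using measure_Diff[of "leb K" Y X] fmeasurable_subset_cube[of K Y] assms
  by (auto simp: fmeasurable_def)

lemma vol_full_region_diff:
  "vol I (full_region I low) - vol I (full_region I q) =
     (\<Sum>A\<in>F. vol A (full_region A q) * vol (I - A) (slab A))"
proof -
  have "vol I (full_region I low) - vol I (full_region I q) = vol I (\<Union>A\<in>F. piece A)"
    unfolding piecewise_decomposition[symmetric]
    by (intro vol_split full_region_sets full_region_subset finite) (auto simp: full_region_def)
  also have "\<dots> = (\<Sum>A\<in>F. vol I (piece A))"
  proof (intro vol_UNION_disjoint_AE finite finite_F piece_sets)
    fix A C assume AC: "A \<in> F" "C \<in> F" "A \<noteq> C"
    have "piece A \<inter> piece C \<subseteq> {x \<in> extensional I. sum x A - sum x C = q A - q C}"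
    proof
      fix x assume x: "x \<in> piece A \<inter> piece C"
      have "sum x A - q A = sum x C - q C"
        using piece_optimal[OF AC(1), of x C] piece_optimal[OF AC(2), of x A] x AC F_D by force
      moreover have "x \<in> cube I" using x pieceD(1)[OF AC(1), of x] by simp
      ultimately show "x \<in> {x \<in> extensional I. sum x A - sum x C = q A - q C}"
        by (auto simp: PiE_def)
    qed
    then show "\<exists>N \<in> null_sets (leb I). piece A \<inter> piece C \<subseteq> N"
      using hyperplane_null[OF finite, of A C] AC F_D by blast
  qed (use pieceD(1) in auto)
  also have "\<dots> = (\<Sum>A\<in>F. vol A (full_region A q) * vol (I - A) (slab A))"
  proof (rule sum.cong)
    fix A assume A: "A \<in> F"
    show "vol I (piece A) = vol A (full_region A q) * vol (I - A) (slab A)"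
      using vol_glue_region[of A "I - A" "full_region A q" "slab A"] F_D[OF A] finite
        full_region_sets[of A q] slab_sets[of A] by (simp add: piece_def)
  qed simp
  finally show ?thesis .
qed

text \<open>A buyer of \<open>A\<close> has valuation at most \<open>q (A \<union> {i}) - q A\<close> for each further item \<open>i\<close>, which
  is at most \<open>q {i} < 1\<close> by submodularity. So a piece meets the face \<open>x\<^sub>i = 1\<close> only if
  \<open>i\<close> belongs to \<open>A\<close>, and then the second factor of the product is left untouched.\<close>

lemma top_face_piece:
  assumes A: "A \<in> F" and i: "i \<in> I"
  shows "top_face I i (piece A) =
    (if i \<in> A then glue_region (A - {i}) (top_face A i (full_region A q)) (I - A) (slab A) else {})"
proof (cases "i \<in> A")
  case True
  have un: "A - {i} \<union> (I - A) = I - {i}" using True F_D[OF A] by auto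
  have r: "restrict (z(i := 1)) A = (restrict z (A - {i}))(i := 1)" for z :: "nat \<Rightarrow> real"
    using True by (auto simp: restrict_def fun_eq_iff)
  have s: "restrict (z(i := 1)) (I - A) = restrict z (I - A)" for z :: "nat \<Rightarrow> real"
    using True by (auto simp: restrict_def fun_eq_iff)
  have e: "z(i := 1) \<in> extensional I" if "z \<in> extensional (I - {i})" for z :: "nat \<Rightarrow> real"
    using that i by (auto simp: extensional_def)
  show ?thesis
    using True F_D(3)[OF A] e by (auto simp: top_face_def piece_def glue_region_def un r s)
next
  case False
  have "z(i := 1) \<notin> piece A" for z
  proof
    assume z: "z(i := 1) \<in> piece A"
    have "sum (z(i := 1)) {i} \<le> q (A \<union> {i}) - q A"
      by (rule pieceD(3)[OF A z]) (use False i in auto)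
    moreover have "q (A \<union> {i}) + q (A \<inter> {i}) \<le> q A + q {i}"
      by (rule submod) (use F_D A i in auto)
    ultimately show False using single[OF i] False q_empty by simp
  qed
  then show ?thesis using False by (auto simp: top_face_def)
qed

lemma vol_top_face_diff:
  assumes i: "i \<in> I"
  shows "vol (I - {i}) (top_face I i (full_region I low)) - vol (I - {i}) (top_face I i (full_region I q)) =
    (\<Sum>A\<in>F. if i \<in> A then vol (A - {i}) (top_face A i (full_region A q)) * vol (I - A) (slab A) else 0)"
proof -
  let ?K = "I - {i}"
  have finK: "finite ?K" using finite by auto
  have "vol ?K (top_face I i (full_region I low)) - vol ?K (top_face I i (full_region I q)) =
      vol ?K (top_face I i (full_region I low) - top_face I i (full_region I q))"
    by (intro vol_split finK top_face_sets i full_region_sets finite top_face_subset_cube)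
      (use full_region_subset in \<open>auto simp: top_face_def full_region_def\<close>)
  also have "top_face I i (full_region I low) - top_face I i (full_region I q) =
      top_face I i (full_region I low - full_region I q)" by (auto simp: top_face_def)
  also have "\<dots> = (\<Union>A\<in>F. top_face I i (piece A))"
    by (auto simp: piecewise_decomposition top_face_def)
  also have "vol ?K \<dots> = (\<Sum>A\<in>F. vol ?K (top_face I i (piece A)))"
  proof (intro vol_UNION_disjoint_AE finK finite_F top_face_sets piece_sets i top_face_subset_cube)
    fix A C assume AC: "A \<in> F" "C \<in> F" "A \<noteq> C"
    show "\<exists>N \<in> null_sets (leb ?K). top_face I i (piece A) \<inter> top_face I i (piece C) \<subseteq> N"
    proof (cases "i \<in> A \<and> i \<in> C")
      case True
      have "top_face I i (piece A) \<inter> top_face I i (piece C) \<subseteq>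
          {z \<in> extensional ?K. sum z (A - {i}) - sum z (C - {i}) = q A - q C}"
      proof
        fix z assume z: "z \<in> top_face I i (piece A) \<inter> top_face I i (piece C)"
        let ?x = "z(i := 1)"
        have "?x \<in> piece A" "?x \<in> piece C" using z by (auto simp: top_face_def)
        then have "sum ?x A - q A = sum ?x C - q C"
          using piece_optimal[OF AC(1), of ?x C] piece_optimal[OF AC(2), of ?x A] AC F_D by force
        moreover have "sum ?x B = 1 + sum z (B - {i})" if "B \<in> F" "i \<in> B" for B
        proof -
          have "sum ?x B = ?x i + sum ?x (B - {i})"
            using F_D(2)[OF that(1)] that(2) by (rule sum.remove)
          moreover have "sum ?x (B - {i}) = sum z (B - {i})" by (rule sum.cong) auto
          ultimately show ?thesis by simp
        qed
        ultimately show "z \<in> {z \<in> extensional ?K. sum z (A - {i}) - sum z (C - {i}) = q A - q C}"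
          using z True AC by (auto simp: top_face_def)
      qed
      \<comment> \<open>Since both bundles contain \<open>i\<close>, they still differ on the face, and their ties form a hyperplane there.\<close>
      moreover have "A - {i} \<noteq> C - {i}" using AC(3) True by blast
      ultimately show ?thesis
        using hyperplane_null[OF finK, of "A - {i}" "C - {i}"] AC F_D
        by (meson Diff_mono order_refl)
    next
      case False
      then show ?thesis using AC i by (auto simp: top_face_piece intro!: bexI[of _ "{}"])
    qed
  qed (use pieceD(1) in auto)
  also have "\<dots> = (\<Sum>A\<in>F. if i \<in> A then vol (A - {i}) (top_face A i (full_region A q)) * vol (I - A) (slab A) else 0)"
  proof (rule sum.cong)
    fix A assume A: "A \<in> F"
    show "vol ?K (top_face I i (piece A)) =
      (if i \<in> A then vol (A - {i}) (top_face A i (full_region A q)) * vol (I - A) (slab A) else 0)"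
    proof (cases "i \<in> A")
      case True
      have "A - {i} \<union> (I - A) = ?K" "(A - {i}) \<inter> (I - A) = {}" using True F_D[OF A] by auto
      then show ?thesis
        using vol_glue_region[of "A - {i}" "I - A" "top_face A i (full_region A q)" "slab A"] F_D[OF A] finite
          top_face_sets[OF True full_region_sets] slab_sets[of A] True by (simp add: top_face_piece[OF A i])
    next
      case False
      then show ?thesis by (simp add: top_face_piece[OF A i] vol_def)
    qed
  qed simp
  finally show ?thesis .
qed

text \<open>Both the volume and the faces of a piece carry the factor \<open>vol (slab A)\<close>. What remains is the
  deficiency of the smaller bundle \<open>A\<close>, with the same factor \<open>1 / (n + 1)\<close>, as this factor does not
  depend on the size of the bundle.\<close>

lemma deficiency_diff:
  "deficiency n I low - deficiency n I q = (\<Sum>A\<in>F. vol (I - A) (slab A) * deficiency n A q)"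
proof -
  let ?f = "\<lambda>A i. vol (A - {i}) (top_face A i (full_region A q))"
  let ?s = "\<lambda>A. vol (I - A) (slab A)"
  have "(\<Sum>i\<in>I. vol (I - {i}) (top_face I i (full_region I low))) - (\<Sum>i\<in>I. vol (I - {i}) (top_face I i (full_region I q)))
    = (\<Sum>i\<in>I. \<Sum>A\<in>F. if i \<in> A then ?f A i * ?s A else 0)"
    unfolding sum_subtractf[symmetric] by (intro sum.cong refl vol_top_face_diff)
  also have "\<dots> = (\<Sum>A\<in>F. \<Sum>i\<in>I. if i \<in> A then ?f A i * ?s A else 0)" by (rule sum.swap)
  also have "\<dots> = (\<Sum>A\<in>F. ?s A * (\<Sum>i\<in>A. ?f A i))"
  proof (rule sum.cong)
    fix A assume "A \<in> F"
    then have "I \<inter> A = A" using F_D by auto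
    then show "(\<Sum>i\<in>I. if i \<in> A then ?f A i * ?s A else 0) = ?s A * (\<Sum>i\<in>A. ?f A i)"
      using finite by (subst sum.inter_restrict[symmetric]) (auto simp: sum_distrib_left mult.commute)
  qed simp
  finally have faces: "(\<Sum>i\<in>I. vol (I - {i}) (top_face I i (full_region I low)))
     - (\<Sum>i\<in>I. vol (I - {i}) (top_face I i (full_region I q))) = (\<Sum>A\<in>F. ?s A * (\<Sum>i\<in>A. ?f A i))" .
  have "deficiency n I low - deficiency n I q =
      (vol I (full_region I low) - vol I (full_region I q)) - 1 / (real n + 1) *
      ((\<Sum>i\<in>I. vol (I - {i}) (top_face I i (full_region I low))) - (\<Sum>i\<in>I. vol (I - {i}) (top_face I i (full_region I q))))"
    by (simp add: deficiency_def algebra_simps diff_divide_distrib)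
  also have "\<dots> = (\<Sum>A\<in>F. vol A (full_region A q) * ?s A) - 1 / (real n + 1) * (\<Sum>A\<in>F. ?s A * (\<Sum>i\<in>A. ?f A i))"
    by (simp only: faces vol_full_region_diff)
  also have "\<dots> = (\<Sum>A\<in>F. ?s A * deficiency n A q)"
    by (simp add: deficiency_def sum_subtractf sum_distrib_left right_diff_distrib mult.commute mult.left_commute)
  finally show ?thesis .
qed

text \<open>The greedy vertex of the base polytope of the submodular function \<open>q\<close>: items are added one
  at a time, each valued at its marginal price.\<close>

lemma base_exists:
  "K \<subseteq> I \<Longrightarrow> \<exists>y. (\<forall>i\<in>K. 0 \<le> y i) \<and> (\<forall>C\<subseteq>K. sum y C \<le> q C) \<and> sum y K = q K"
proof (induction K rule: infinite_finite_induct)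
  case (infinite K)
  then show ?case using finite finite_subset by blast
next
  case empty
  then show ?case using q_empty by auto
next
  case (insert j K)
  then obtain y where y: "\<And>i. i \<in> K \<Longrightarrow> 0 \<le> y i" "\<And>C. C \<subseteq> K \<Longrightarrow> sum y C \<le> q C" "sum y K = q K" by auto
  let ?z = "y(j := q (insert j K) - q K)"
  have same: "sum ?z C = sum y C" if "j \<notin> C" for C using that by (intro sum.cong) auto
  have "q K \<le> q (insert j K)" using insert by (intro mono) auto
  then have "\<forall>i\<in>insert j K. 0 \<le> ?z i" using y by auto
  moreover have "sum ?z C \<le> q C" if C: "C \<subseteq> insert j K" for C
  proof (cases "j \<in> C")
    case True
    let ?D = "C - {j}"
    have fin: "finite C" using C insert finite_subset by blast
    have "q (C \<union> K) + q (C \<inter> K) \<le> q C + q K" using C insert by (intro submod) auto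
    moreover have "C \<union> K = insert j K" "C \<inter> K = ?D" using C True insert by auto
    moreover have "sum ?z C = ?z j + sum ?z ?D" using fin True by (rule sum.remove)
    moreover have "sum ?z ?D = sum y ?D" by (rule same) auto
    moreover have "sum y ?D \<le> q ?D" using C by (intro y) auto
    ultimately show ?thesis by simp
  next
    case False
    then have "C \<subseteq> K" using C by auto
    then show ?thesis using same[OF False] y(2) by (simp del: fun_upd_apply)
  qed
  moreover have "sum ?z (insert j K) = q (insert j K)"
    using insert same[of K] y by (simp del: fun_upd_apply) simp
  ultimately show ?case by blast
qed

text \<open>Scaling the greedy vertex down slightly makes all upper bounds in \<open>slab {}\<close> strict while
  the total value stays at least \<open>t\<close>. Then a small box above the scaled point fits into the slab.\<close>

lemma slab_empty_pos: "0 < vol I (slab {})"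
proof -
  obtain y where y0: "\<And>i. i \<in> I \<Longrightarrow> 0 \<le> y i" and yC: "\<And>C. C \<subseteq> I \<Longrightarrow> sum y C \<le> q C" and yI: "sum y I = q I"
    using base_exists[of I] by auto
  have qpos: "0 < q C" if "C \<subseteq> I" "C \<noteq> {}" for C
  proof -
    obtain i where "i \<in> C" using \<open>C \<noteq> {}\<close> by blast
    then have "q {i} \<le> q C" using that by (intro mono) auto
    then show ?thesis using single[of i] \<open>i \<in> C\<close> that by auto
  qed
  have qI: "0 < q I" using qpos nonempty by auto
  \<comment> \<open>The scaling factor \<open>1 - e\<close> keeps \<open>(1 - e) * q I \<ge> t\<close>.\<close>
  define e where "e = min 1 ((q I - t) / q I)"
  have e: "0 < e" "e \<le> 1" "e * q I \<le> q I - t"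
    using less qI by (auto simp: e_def min_def field_simps)
  define r where "r = Min (insert 1 (q ` (Pow I - {{}})))"
  have fin: "finite (insert 1 (q ` (Pow I - {{}})))" using finite by auto
  have r: "0 < r" unfolding r_def using fin qpos by (subst Min_gr_iff) auto
  have r_le: "\<And>C. C \<subseteq> I \<Longrightarrow> C \<noteq> {} \<Longrightarrow> r \<le> q C" unfolding r_def using fin by (auto intro!: Min_le)
  have card_pos: "0 < card I" using finite nonempty by (simp add: card_gt_0_iff)
  \<comment> \<open>All coordinates together gain at most \<open>e * r / 2\<close>, whereas scaling by \<open>1 - e\<close> has left a gap of at least
    \<open>e * r\<close> below each bound.\<close>
  define k where "k = e * r / (2 * real (card I))"
  have k: "0 < k" "real (card I) * k = e * r / 2"
    using e r card_pos by (auto simp: k_def)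
  let ?B = "Pi\<^sub>E I (\<lambda>i. {(1 - e) * y i..(1 - e) * y i + k})"
  have "?B \<subseteq> slab {}"
  proof
    fix z assume z: "z \<in> ?B"
    have lo: "(1 - e) * y i \<le> z i" and hi: "z i \<le> (1 - e) * y i + k" if "i \<in> I" for i
      using z that by (auto simp: PiE_iff)
    have up: "sum z C < q C" if C: "C \<subseteq> I" "C \<noteq> {}" for C
    proof -
      have "sum z C \<le> (\<Sum>i\<in>C. (1 - e) * y i + k)" using C hi by (intro sum_mono) auto
      also have "\<dots> = (1 - e) * sum y C + real (card C) * k" by (simp add: sum.distrib sum_distrib_left)
      also have "\<dots> \<le> (1 - e) * q C + real (card I) * k"
        using e k C yC[OF C(1)] card_mono[OF finite C(1)]
        by (intro add_mono mult_left_mono mult_right_mono) auto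
      also have "\<dots> < q C"
      proof -
        have "real (card I) * k < e * r" using k(2) mult_pos_pos[OF e(1) r] by simp
        also have "e * r \<le> e * q C" using e(1) r_le[OF C] by simp
        finally show ?thesis by (simp add: algebra_simps)
      qed
      finally show ?thesis .
    qed
    have z0: "0 \<le> z i" if "i \<in> I" for i
      using lo[OF that] y0[OF that] e by (smt (verit) mult_nonneg_nonneg)
    have "z \<in> cube I"
    proof (rule PiE_I)
      fix i assume i: "i \<in> I"
      have "sum z {i} < q {i}" using i by (intro up) auto
      then show "z i \<in> {0..1}" using single[OF i] z0[OF i] by simp
    qed (use z in \<open>auto simp: PiE_def extensional_def\<close>)
    moreover have "sum z C \<le> q C" if "C \<subseteq> I" for C
      using up[OF that] q_empty by (cases "C = {}") auto
    moreover have "sum z I < q I" using up nonempty by auto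
    moreover have "t \<le> sum z I"
    proof -
      have "(1 - e) * q I = (\<Sum>i\<in>I. (1 - e) * y i)" by (simp add: yI[symmetric] sum_distrib_left)
      also have "\<dots> \<le> sum z I" using lo by (intro sum_mono) auto
      finally show ?thesis using e(3) by (simp add: algebra_simps)
    qed
    ultimately show "z \<in> slab {}" using q_empty by (auto simp: slab_def)
  qed
  moreover have "slab {} \<in> fmeasurable (leb I)"
    using slab_sets[of "{}"] finite by (intro fmeasurable_subset_cube) (auto simp: slab_def)
  moreover have "?B \<in> sets (leb I)" using finite by (intro sets_PiM_I_finite) auto
  ultimately have "vol I ?B \<le> vol I (slab {})"
    unfolding vol_def by (intro measure_mono_fmeasurable)
  moreover have "vol I ?B = (\<Prod>i\<in>I. k)"
    by (subst vol_box) (use finite k in auto)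
  ultimately show ?thesis using k by (smt (verit) prod_pos)
qed

lemma deficiency_empty: "deficiency n {} q = 1"
proof -
  have "full_region {} q = {\<lambda>_. undefined}" by (auto simp: full_region_def)
  then show ?thesis by (simp add: deficiency_def vol_def measure_def)
qed

text \<open>If the smaller bundles have deficiency zero, then the only summand that survives in
  the preceding formula is that of the empty bundle, whose deficiency is \<open>1\<close>.\<close>

lemma deficiency_decreases:
  assumes "\<And>A. A \<in> F \<Longrightarrow> A \<noteq> {} \<Longrightarrow> deficiency n A q = 0"
  shows "deficiency n I q < deficiency n I low"
proof -
  have "(\<Sum>A\<in>F. vol (I - A) (slab A) * deficiency n A q) = vol I (slab {})"
    using sum.remove[OF finite_F F(2), of "\<lambda>A. vol (I - A) (slab A) * deficiency n A q"] assms
    by (simp add: deficiency_empty)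
  then show ?thesis using deficiency_diff[of n] slab_empty_pos by simp
qed

end

section \<open>Relabelling items\<close>

lemma full_region_cube: "x \<in> full_region I p \<Longrightarrow> x \<in> cube I"
  by (simp add: full_region_def)

lemma region_cube: "x \<in> region n p I \<Longrightarrow> x \<in> cube {1..n}"
  by (simp add: region_def)

lemma full_region_extensional: "full_region I p \<subseteq> extensional I"
  using full_region_cube by (auto simp: PiE_def)

text \<open>The deficiency sees the names of the items only through the prices.\<close>

lemma deficiency_reindex:
  assumes fin: "finite I" and f: "bij_betw f I J"
  shows "deficiency n I (\<lambda>A. p (f ` A)) = deficiency n J p"
proof -
  let ?p = "\<lambda>A. p (f ` A)"
  let ?T = "\<lambda>x. \<lambda>k\<in>I. x (f k)"
  have J: "J = f ` I" and inj: "inj_on f I" using f by (auto simp: bij_betw_def)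
  have sum_T: "sum (?T x) (I - A) = sum x (J - f ` A)" if "A \<subseteq> I" for x :: "nat \<Rightarrow> real" and A
  proof -
    have "J - f ` A = f ` (I - A)" using inj that J by (simp add: inj_on_image_set_diff)
    moreover have "inj_on f (I - A)" using inj by (rule inj_on_subset) auto
    ultimately show ?thesis by (simp add: sum.reindex)
  qed
  have T_region: "?T y \<in> full_region I ?p \<longleftrightarrow> y \<in> full_region J p" if y: "y \<in> extensional J" for y
  proof -
    have "?T y \<in> cube I \<longleftrightarrow> y \<in> cube J" using y by (auto simp: PiE_def J Pi_iff)
    moreover have "(\<forall>A\<subseteq>I. ?p I - ?p A \<le> sum (?T y) (I - A)) \<longleftrightarrow> (\<forall>B\<subseteq>J. p J - p B \<le> sum y (J - B))"
      unfolding J all_subset_image using sum_T[of _ y] J by (auto simp: sum_T)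
    ultimately show ?thesis unfolding full_region_def by blast
  qed
  have "vol I (full_region I ?p) = vol J {y \<in> extensional J. ?T y \<in> full_region I ?p}"
    by (rule vol_reindex[OF fin f full_region_sets[OF fin]])
  also have "{y \<in> extensional J. ?T y \<in> full_region I ?p} = full_region J p"
    using T_region full_region_extensional[of J p] by blast
  finally have volume: "vol I (full_region I ?p) = vol J (full_region J p)" .
  have face: "vol (I - {i}) (top_face I i (full_region I ?p)) = vol (J - {f i}) (top_face J (f i) (full_region J p))"
    if i: "i \<in> I" for i
  proof -
    let ?S = "\<lambda>x. \<lambda>k\<in>I - {i}. x (f k)"
    have "bij_betw f (I - {i}) (J - {f i})"
      using f i by (intro bij_betw_DiffI) (auto simp: J)
    then have "vol (I - {i}) (top_face I i (full_region I ?p)) =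
        vol (J - {f i}) {y \<in> extensional (J - {f i}). ?S y \<in> top_face I i (full_region I ?p)}"
      using fin i by (intro vol_reindex top_face_sets full_region_sets) auto
    also have "{y \<in> extensional (J - {f i}). ?S y \<in> top_face I i (full_region I ?p)} =
        top_face J (f i) (full_region J p)"
    proof -
      have "?S y \<in> top_face I i (full_region I ?p) \<longleftrightarrow> y(f i := 1) \<in> full_region J p"
        if y: "y \<in> extensional (J - {f i})" for y
      proof -
        have "(?S y)(i := 1) = ?T (y(f i := 1))"
          using i inj by (auto simp: fun_eq_iff inj_on_def restrict_def)
        moreover have "y(f i := 1) \<in> extensional J" using y i J by (auto simp: extensional_def)
        ultimately show ?thesis using T_region by (simp add: top_face_def del: fun_upd_apply)
      qed
      then show ?thesis by (auto simp: top_face_def simp del: fun_upd_apply)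
    qed
    finally show ?thesis .
  qed
  have "(\<Sum>i\<in>I. vol (I - {i}) (top_face I i (full_region I ?p))) =
      (\<Sum>j\<in>J. vol (J - {j}) (top_face J j (full_region J p)))"
    using sum.reindex_bij_betw[OF f, of "\<lambda>j. vol (J - {j}) (top_face J j (full_region J p))"] face by simp
  then show ?thesis by (simp add: deficiency_def volume)
qed

section \<open>Projections of regions\<close>

text \<open>A bundle whose region contains some valuation is no more expensive than its supersets, since
  valuations are nonnegative; all other bundles are covered by normalization.\<close>

lemma schedule_mono:
  assumes p: "price_schedule n p" and AB: "A \<subseteq> B" "B \<subseteq> {1..n}"
  shows "p A \<le> p B"
proof (cases "A = B")
  case False
  then have sub: "A \<subset> B" using AB by auto
  show ?thesis
  proof (cases "vol {1..n} (region n p A) = 0")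
    case True
    have "finite {p J |J. A \<subset> J \<and> J \<subseteq> {1..n}}" by simp
    moreover have "p B \<in> {p J |J. A \<subset> J \<and> J \<subseteq> {1..n}}" using sub AB by auto
    moreover have "p A = Min {p J |J. A \<subset> J \<and> J \<subseteq> {1..n}}"
      using p True sub AB unfolding price_schedule_def normalized_def by blast
    ultimately show ?thesis by (simp only: Min_le)
  next
    case False
    then have "region n p A \<noteq> {}" by (auto simp: vol_def)
    then obtain x where x: "x \<in> region n p A" by auto
    then have "sum x B - p B \<le> sum x A - p A" using AB unfolding region_def by blast
    moreover have "sum x A \<le> sum x B"
      using region_cube[OF x] AB finite_subset[OF AB(2)] by (intro sum_mono2) (auto simp: PiE_iff)
    ultimately show ?thesis by simp
  qed
qed simp

text \<open>A valuation of the items in \<open>I\<close> is best extended by \<open>0\<close>. Then, by monotonicity of prices,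
  a bundle \<open>J\<close> attracts no more than \<open>I \<inter> J\<close> does, and only subsets of \<open>I\<close> remain to be compared.\<close>

lemma bar_region_eq_full_region:
  assumes p: "price_schedule n p" and I: "I \<subseteq> {1..n}"
  shows "bar_region n p I = full_region I p"
proof (intro equalityI subsetI)
  have finI: "finite I" using I finite_subset by auto
  {
    fix z assume "z \<in> bar_region n p I"
    then obtain x where x: "x \<in> region n p I" and z: "z = restrict x I"
      by (auto simp: bar_region_def proj_def)
    have "p I - p A \<le> sum z (I - A)" if A: "A \<subseteq> I" for A
    proof -
      have "sum x A - p A \<le> sum x I - p I" using x A I unfolding region_def by blast
      moreover have "sum x I = sum x A + sum x (I - A)"
        using sum.subset_diff[OF A finI, of x] by simp
      moreover have "sum z (I - A) = sum x (I - A)" unfolding z by (rule sum_restrict_subset) auto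
      ultimately show ?thesis by simp
    qed
    moreover have "z \<in> cube I" using region_cube[OF x] I by (auto simp: z PiE_iff)
    ultimately show "z \<in> full_region I p" unfolding full_region_def by blast
  next
    fix z assume z: "z \<in> full_region I p"
    define x where "x = (\<lambda>i\<in>{1..n}. if i \<in> I then z i else 0)"
    have on: "sum x B = sum z B" if "B \<subseteq> I" for B
      using that I by (intro sum.cong) (auto simp: x_def)
    have "sum x J - p J \<le> sum x I - p I" if J: "J \<subseteq> {1..n}" for J
    proof -
      have "sum x J = sum x (J \<inter> I)"
        using finite_subset[OF J] J by (intro sum.mono_neutral_right) (auto simp: x_def)
      then have "sum x J = sum z (I \<inter> J)" using on[of "J \<inter> I"] by (simp add: Int_commute)
      moreover have "p I - p (I \<inter> J) \<le> sum z (I - I \<inter> J)" using z unfolding full_region_def by blast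
      moreover have "sum x I = sum z (I \<inter> J) + sum z (I - I \<inter> J)"
        using sum.subset_diff[of "I \<inter> J" I z] finI on[of I] by simp
      moreover have "p (I \<inter> J) \<le> p J" by (rule schedule_mono[OF p]) (use J in auto)
      ultimately show ?thesis by simp
    qed
    moreover have "x \<in> cube {1..n}" using full_region_cube[OF z] by (auto simp: x_def PiE_iff)
    ultimately have "x \<in> region n p I" unfolding region_def by blast
    moreover have "restrict x I = z"
    proof
      fix k show "restrict x I k = z k"
        using full_region_cube[OF z] I by (cases "k \<in> I") (auto simp: x_def PiE_def extensional_def)
    qed
    ultimately show "z \<in> bar_region n p I" unfolding bar_region_def proj_def by blast
  }
qed

lemma proj_full_region:
  assumes fin: "finite I" and i: "i \<in> I"
  shows "proj (I - {i}) (full_region I p) = top_face I i (full_region I p)"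
proof (intro equalityI subsetI)
  fix z assume "z \<in> proj (I - {i}) (full_region I p)"
  then obtain x where x: "x \<in> full_region I p" and z: "z = restrict x (I - {i})"
    unfolding proj_def by blast
  have eq: "z(i := 1) = x(i := 1)"
    using PiE_arb[OF full_region_cube[OF x]] by (auto simp: z fun_eq_iff)
  have le: "x k \<le> (x(i := 1)) k" if "k \<in> I" for k
    using full_region_cube[OF x] that by (auto simp: PiE_iff)
  have "p I - p A \<le> sum (x(i := 1)) (I - A)" if A: "A \<subseteq> I" for A
  proof -
    have "p I - p A \<le> sum x (I - A)" using x A unfolding full_region_def by blast
    also have "\<dots> \<le> sum (x(i := 1)) (I - A)" by (intro sum_mono le) auto
    finally show ?thesis .
  qed
  moreover have "x(i := 1) \<in> cube I"
    using PiE_fun_upd[OF _ full_region_cube[OF x], of 1 i] i by (simp add: insert_absorb)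
  ultimately have "z(i := 1) \<in> full_region I p"
    unfolding eq full_region_def by blast
  then show "z \<in> top_face I i (full_region I p)" by (simp add: top_face_def z)
next
  fix z assume z: "z \<in> top_face I i (full_region I p)"
  then have "restrict (z(i := 1)) (I - {i}) = z"
    by (auto simp: top_face_def extensional_def fun_eq_iff)
  moreover have "z(i := 1) \<in> full_region I p" using z by (simp add: top_face_def)
  ultimately show "z \<in> proj (I - {i}) (full_region I p)" unfolding proj_def by (metis imageI)
qed

lemma delta_eq_deficiency:
  assumes "price_schedule n p" "I \<subseteq> {1..n}"
  shows "delta n p I = deficiency n I p"
proof -
  have "proj I (region n p I) = full_region I p"
    using bar_region_eq_full_region[OF assms] by (simp add: bar_region_def)
  moreover have "finite I" using assms(2) finite_subset by auto
  ultimately show ?thesis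
    using proj_full_region[of I]
    by (simp add: delta_def deficiency_def bar_region_def bar_region_facet_def)
qed

section \<open>Critical submodular schedules\<close>

locale critical_schedule =
  fixes n :: nat and S :: "nat set set" and p :: "nat set \<Rightarrow> real"
  assumes candidate: "selling_candidate n S"
    and schedule: "price_schedule n p"
    and critical: "critical n p S"
    and submodular: "submodular n p"
begin

lemma S_subset: "I \<in> S \<Longrightarrow> I \<subseteq> {1..n}"
  using candidate by (auto simp: selling_candidate_def)

lemma S_down: "I \<in> S \<Longrightarrow> I \<noteq> {1..n} \<Longrightarrow> J \<subseteq> I \<Longrightarrow> J \<in> S"
  using candidate unfolding selling_candidate_def by blast

lemma S_singleton: "i \<in> {1..n} \<Longrightarrow> {i} \<in> S"
  using candidate unfolding selling_candidate_def by blast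

lemma price_empty: "p {} = 0"
  using schedule by (simp add: price_schedule_def)

lemma deficiency_zero: "I \<in> S \<Longrightarrow> I \<noteq> {} \<Longrightarrow> deficiency n I p = 0"
  using critical delta_eq_deficiency[OF schedule S_subset] by (auto simp: critical_def)

text \<open>If an item had a nonpositive price, then its region would be the whole unit interval, with
  deficiency \<open>1 - 1 / (n + 1)\<close>.\<close>

lemma price_single_pos:
  assumes i: "i \<in> {1..n}"
  shows "0 < p {i}"
proof (rule ccontr)
  assume "\<not> 0 < p {i}"
  then have "p {i} - p A \<le> sum x ({i} - A)" if "A \<subseteq> {i}" "x \<in> cube {i}" for A x
    using that PiE_mem[OF that(2), of i] by (auto simp: subset_singleton_iff price_empty)
  then have "full_region {i} p = cube {i}"
    unfolding full_region_def by blast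
  moreover have "z(i := 1) \<in> cube {i}" if "z \<in> extensional {}" for z :: "nat \<Rightarrow> real"
    using that by (auto simp: PiE_iff extensional_def)
  then have "top_face {i} i (cube {i}) = cube {}"
    unfolding top_face_def PiE_empty_domain by auto
  moreover have "vol I (cube I) = 1" if "finite I" for I
    using vol_box[OF that, of "\<lambda>_. 0" "\<lambda>_. 1"] by simp
  moreover have "vol {} {\<lambda>_. undefined} = 1" by (simp add: vol_def measure_def)
  ultimately have "deficiency n {i} p = 1 - 1 / (real n + 1)"
    by (simp add: deficiency_def)
  moreover have "deficiency n {i} p = 0" using S_singleton[OF i] by (intro deficiency_zero) auto
  ultimately show False using i by simp
qed

lemma price_single_less_1:
  assumes i: "i \<in> {1..n}"
  shows "p {i} < 1"
proof (rule ccontr)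
  assume ge: "\<not> p {i} < 1"
  let ?H = "{x \<in> extensional {1..n}. sum x {i} - sum x {} = 1}"
  have null: "?H \<in> null_sets (leb {1..n})" using i by (intro hyperplane_null) auto
  have "region n p {i} \<subseteq> ?H"
  proof
    fix x assume x: "x \<in> region n p {i}"
    then have "sum x {} - p {} \<le> sum x {i} - p {i}"
      unfolding region_def mem_Collect_eq by (metis empty_subsetI)
    moreover have "x i \<le> 1" "x \<in> extensional {1..n}"
      using region_cube[OF x] i by (auto simp: PiE_iff)
    ultimately show "x \<in> ?H" using ge price_empty by simp
  qed
  then have "emeasure (leb {1..n}) (region n p {i}) \<le> emeasure (leb {1..n}) ?H"
    using null by (intro emeasure_mono) auto
  then have "emeasure (leb {1..n}) (region n p {i}) = 0"
    using null_setsD1[OF null] by simp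
  then have "vol {1..n} (region n p {i}) = 0" by (simp add: vol_def measure_def)
  then show False using critical S_singleton[OF i] i by (auto simp: critical_def admits_def)
qed

text \<open>Normalization passes the price down from the supersets. These are unsold too, as
  candidates are closed downwards, until the full bundle is reached.\<close>

lemma price_unsold:
  assumes "A \<subseteq> {1..n}" "A \<notin> S"
  shows "p A = p {1..n}"
  using assms
proof (induction "n - card A" arbitrary: A rule: less_induct)
  case less
  have sub: "A \<subset> {1..n}" using less.prems candidate by (auto simp: selling_candidate_def)
  have above: "p J = p {1..n}" if J: "A \<subset> J" "J \<subseteq> {1..n}" for J
  proof (cases "J = {1..n}")
    case False
    then have "J \<notin> S" using S_down[of J A] J(1) less.prems(2) by blast
    moreover have "card A < card J" using psubset_card_mono[OF finite_subset[OF J(2)] J(1)] by simp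
    moreover have "card J \<le> n" using card_mono[OF _ J(2)] by simp
    ultimately show ?thesis using J(2) less.hyps[of J] by simp
  qed simp
  have "\<not> 0 < vol {1..n} (region n p A)"
    using critical less.prems unfolding critical_def admits_def by blast
  then have "vol {1..n} (region n p A) = 0" by (simp add: vol_def zero_less_measure_iff)
  then have "p A = Min {p J |J. A \<subset> J \<and> J \<subseteq> {1..n}}"
    using schedule sub unfolding price_schedule_def normalized_def by blast
  also have "{p J |J. A \<subset> J \<and> J \<subseteq> {1..n}} = {p {1..n}}"
    using above sub by blast
  finally show ?case by simp
qed

lemma S_empty:
  assumes "0 < n"
  shows "{} \<in> S"
proof (rule ccontr)
  assume "{} \<notin> S"
  then have "p {1..n} = 0" using price_unsold[of "{}"] price_empty by simp
  moreover have "p {1} \<le> p {1..n}" by (rule schedule_mono[OF schedule]) (use assms in auto)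
  ultimately show False using price_single_pos[of 1] assms by auto
qed

text \<open>The comparison that yields both uniqueness and symmetry: no competing price system \<open>r\<close> that
  agrees with \<open>p\<close> on the sold proper subsets of \<open>I\<close>, charges the price of \<open>I\<close> for the unsold ones and has
  zero deficiency at \<open>I\<close> can offer \<open>I\<close> at a lower price. For uniqueness \<open>r\<close> is a second critical schedule, for symmetry it is \<open>p\<close> with items relabelled.\<close>

lemma deficiency_pos_if_cheaper:
  assumes I: "I \<in> S" "I \<noteq> {}" and less: "r I < p I"
    and on: "\<And>A. A \<in> S \<Longrightarrow> A \<subset> I \<Longrightarrow> r A = p A"
    and off: "\<And>A. A \<notin> S \<Longrightarrow> A \<subset> I \<Longrightarrow> r A = r I"
  shows "0 < deficiency n I r"
proof -
  have In: "I \<subseteq> {1..n}" using S_subset I by auto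
  define F where "F = {A \<in> S. A \<subset> I}"
  interpret raised_price I p "r I" F
  proof
    show "finite I" using In finite_subset by auto
    show "{} \<in> F" using S_empty I In by (auto simp: F_def)
    show "p A = p I" if A: "A \<subseteq> I" "A \<notin> F" for A
    proof (cases "A = I")
      case False
      then have "A \<notin> S" using A by (auto simp: F_def)
      then have "I = {1..n}" using S_down[OF I(1) _ A(1)] by auto
      then show ?thesis using price_unsold \<open>A \<notin> S\<close> A by auto
    qed simp
    show "p A \<le> p B" if "A \<subseteq> B" "B \<subseteq> I" for A B
      using schedule_mono[OF schedule] that In by (meson order_trans)
    show "p (A \<union> B) + p (A \<inter> B) \<le> p A + p B" if "A \<subseteq> I" "B \<subseteq> I" for A B
      using submodular that In unfolding submodular_def by (meson order_trans)
    show "0 < p {i} \<and> p {i} < 1" if "i \<in> I" for i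
      using that In price_single_pos price_single_less_1 by auto
  qed (use I less price_empty in \<open>auto simp: F_def\<close>)
  have "deficiency n I p < deficiency n I low"
    by (rule deficiency_decreases) (auto simp: F_def intro: deficiency_zero)
  also have "deficiency n I low = deficiency n I r"
  proof (rule deficiency_cong)
    fix A assume "A \<subseteq> I"
    then consider "A = I" | "A \<subset> I" by blast
    then show "low A = r A" using on[of A] off[of A] low_simps(3) unfolding low_def
      by cases (simp_all add: F_def)
  qed
  finally show ?thesis using deficiency_zero[OF I] by simp
qed

text \<open>A bijection \<open>f\<close> from \<open>I\<close> to \<open>J\<close> turns the prices on \<open>J\<close> into a second price system on \<open>I\<close>. By induction
  it agrees with \<open>p\<close> on proper subsets, and its deficiency at \<open>I\<close> is that of \<open>J\<close>, hence zero. So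
  neither of the two prices of \<open>I\<close> can be smaller.\<close>

lemma price_depends_on_card:
  assumes "I \<in> S" "J \<in> S" "card I = card J"
  shows "p I = p J"
  using assms
proof (induction "card I" arbitrary: I J rule: less_induct)
  case less
  have fin: "finite K" if "K \<in> S" for K using S_subset[OF that] finite_subset by auto
  have not_less: "\<not> p J < p I" if IJ: "I \<in> S" "J \<in> S" "card I = card J"
    and IH: "\<And>A B. card A < card I \<Longrightarrow> A \<in> S \<Longrightarrow> B \<in> S \<Longrightarrow> card A = card B \<Longrightarrow> p A = p B" for I J
  proof
    assume lt: "p J < p I"
    have ne: "I \<noteq> {}" "J \<noteq> {}"
      using lt IJ(3) fin[OF IJ(1)] fin[OF IJ(2)] by (metis card_0_eq less_irrefl)+
    obtain f where f: "bij_betw f I J" using finite_same_card_bij[OF fin[OF IJ(1)] fin[OF IJ(2)] IJ(3)] by blast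
    have "J = I" if top: "I = {1..n} \<or> J = {1..n}"
    proof (cases "I = {1..n}")
      case True
      have "J \<subseteq> I" using S_subset[OF IJ(2)] True by simp
      then show ?thesis by (rule card_subset_eq[OF fin[OF IJ(1)] _ IJ(3)[symmetric]])
    next
      case False
      then have "I \<subseteq> J" using S_subset[OF IJ(1)] top by simp
      then show ?thesis by (rule card_subset_eq[OF fin[OF IJ(2)] _ IJ(3), symmetric])
    qed
    moreover have "J \<noteq> I" using lt by force
    ultimately have proper: "I \<noteq> {1..n}" "J \<noteq> {1..n}" by blast+
    have img: "f ` A \<in> S \<and> A \<in> S \<and> card A < card I \<and> card (f ` A) = card A" if A: "A \<subset> I" for A
    proof -
      have "f ` A \<subseteq> J" using bij_betw_imp_surj_on[OF f] A by blast
      moreover have "card (f ` A) = card A"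
        using bij_betw_imp_inj_on[OF f] A by (intro card_image) (rule inj_on_subset, auto)
      ultimately show ?thesis
        using S_down[OF IJ(1) proper(1), of A] S_down[OF IJ(2) proper(2), of "f ` A"] A
          psubset_card_mono[OF fin[OF IJ(1)] A] by simp
    qed
    have "0 < deficiency n I (\<lambda>A. p (f ` A))"
    proof (rule deficiency_pos_if_cheaper[OF IJ(1)])
      show "I \<noteq> {}" by (rule ne)
      show "p (f ` I) < p I" by (simp only: bij_betw_imp_surj_on[OF f] lt)
      show "p (f ` A) = p A" if "A \<in> S" "A \<subset> I" for A
        by (rule IH[symmetric]) (use img[OF that(2)] in simp_all)
      show "p (f ` A) = p (f ` I)" if "A \<notin> S" "A \<subset> I" for A
        using img[OF that(2)] that(1) by blast
    qed
    also have "\<dots> = deficiency n J p" using fin[OF IJ(1)] f by (rule deficiency_reindex)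
    also have "\<dots> = 0" using IJ(2) ne(2) by (rule deficiency_zero)
    finally show False by simp
  qed
  have "\<not> p J < p I"
    by (rule not_less[OF less.prems]) (rule less.hyps)
  moreover have "\<not> p I < p J"
    by (rule not_less[OF less.prems(2,1) less.prems(3)[symmetric]])
      (rule less.hyps, simp only: less.prems(3))
  ultimately show ?case by simp
qed

end

lemma critical_schedule_not_cheaper:
  assumes "critical_schedule n S p" "critical_schedule n S q" and I: "I \<in> S"
    and agree: "\<And>A. A \<in> S \<Longrightarrow> A \<subset> I \<Longrightarrow> p A = q A"
  shows "\<not> p I < q I"
proof
  interpret P: critical_schedule n S p by fact
  interpret Q: critical_schedule n S q by fact
  assume less: "p I < q I"
  then have ne: "I \<noteq> {}" using P.price_empty Q.price_empty by force
  have "0 < deficiency n I p"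
  proof (rule Q.deficiency_pos_if_cheaper[where r = p, OF I ne less])
    fix A assume A: "A \<notin> S" "A \<subset> I"
    then have "I = {1..n}" using P.S_down[OF I, of A] by blast
    then show "p A = p I" using P.price_unsold[of A] A by simp
  qed (rule agree)
  then show False using P.deficiency_zero[OF I ne] by simp
qed

lemma critical_schedule_unique:
  assumes p: "critical_schedule n S p" and q: "critical_schedule n S q" and I: "I \<subseteq> {1..n}"
  shows "p I = q I"
proof -
  interpret P: critical_schedule n S p by fact
  interpret Q: critical_schedule n S q by fact
  have on: "p I = q I" if "I \<in> S" for I
    using that
  proof (induction "card I" arbitrary: I rule: less_induct)
    case less
    have "finite I" using P.S_subset[OF less.prems] finite_subset by auto
    then have agree: "p A = q A" if "A \<in> S" "A \<subset> I" for A
      by (rule less.hyps[OF psubset_card_mono[OF _ that(2)] that(1)])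
    have "\<not> p I < q I"
      by (rule critical_schedule_not_cheaper[OF p q less.prems agree])
    moreover have "\<not> q I < p I"
      by (rule critical_schedule_not_cheaper[OF q p less.prems agree[symmetric]])
    ultimately show ?case by simp
  qed
  moreover have "{1..n} \<in> S" using P.candidate by (auto simp: selling_candidate_def)
  ultimately show ?thesis using P.price_unsold[OF I] Q.price_unsold[OF I] by (cases "I \<in> S") simp_all
qed

theorem theorem17:
  fixes n :: nat and \<I> :: "nat set set"
  assumes "selling_candidate n \<I>"
  shows "(\<forall>p q. price_schedule n p \<and> critical n p \<I> \<and> submodular n p \<and>
                price_schedule n q \<and> critical n q \<I> \<and> submodular n q
              \<longrightarrow> (\<forall>I \<subseteq> {1..n}. p I = q I))
       \<and> (\<forall>p. price_schedule n p \<and> critical n p \<I> \<and> submodular n p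
              \<longrightarrow> (\<forall>I \<in> \<I>. \<forall>J \<in> \<I>. card I = card J \<longrightarrow> p I = p J))"
proof -
  have crit: "critical_schedule n \<I> p"
    if "price_schedule n p \<and> critical n p \<I> \<and> submodular n p" for p
    using assms that by (simp add: critical_schedule_def)
  show ?thesis
  proof (intro conjI allI impI ballI)
    fix p q I
    assume "price_schedule n p \<and> critical n p \<I> \<and> submodular n p \<and>
        price_schedule n q \<and> critical n q \<I> \<and> submodular n q" and I: "I \<subseteq> {1..n}"
    then have "critical_schedule n \<I> p" "critical_schedule n \<I> q" using crit by simp_all
    then show "p I = q I" using I by (rule critical_schedule_unique)
  next
    fix p I J
    assume "price_schedule n p \<and> critical n p \<I> \<and> submodular n p"
      and IJ: "I \<in> \<I>" "J \<in> \<I>" "card I = card J"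
    then show "p I = p J" using crit by (intro critical_schedule.price_depends_on_card) simp_all
  qed
qed

end
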